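(* Suppose that the Hopf algebra $\Bbbk^G{}^\tau\#_{\sigma}\Bbbk F$ admits a coquasitriangular structure. Then $O_fO_{f'}=O_{f'}O_f$ for all $f,f'\in F$.
   Context: $\Bbbk$ is an algebraically closed field of characteristic zero, $G$ is a finite group and $F$ is an arbitrary group. $(F,G,\triangleleft,\triangleright)$ is a matched pair of groups: $\triangleleft:G\times F\to G$ is a right action of $F$ on the set $G$ and $\triangleright:G\times F\to F$ is a left action of $G$ on the set $F$, such that $g\triangleright(ff')=(g\triangleright f)((g\triangleleft f)\triangleright f')$ and $(gg')\triangleleft f=(g\triangleleft(g'\triangleright f))(g'\triangleleft f)$ for all $g,g'\in G$, $f,f'\in F$. The maps $\sigma:G\times F\times F\to\Bbbk^\times$ and $\tau:G\times G\times F\to\Bbbk^\times$ satisfy, for all $g,g',g''\in G$, $f,f',f''\in F$: $\sigma(g;1_F,f)=\sigma(g;f,1_F)=\sigma(1_G;f,f')=1$; $\sigma(g\triangleleft f;f',f'')\sigma(g;f,f'f'')=\sigma(g;f,f')\sigma(g;ff',f'')$; $\tau(1_G,g;f)=\tau(g,1_G;f)=\tau(g,g';1_F)=1$; $\tau(g,g';g''\triangleright f)\tau(gg',g'';f)=\tau(g,g'g'';f)\tau(g',g'';f)$; $\sigma(gg';f,f')\tau(g,g';ff')=\sigma(g;g'\triangleright f,(g'\triangleleft f)\triangleright f')\,\sigma(g';f,f')\,\tau(g,g';f)\,\tau(g\triangleleft(g'\triangleright f),g'\triangleleft f;f')$. The Hopf algebra $\Bbbk^G{}^\tau\#_{\sigma}\Bbbk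 F$ is the vector space $\Bbbk^G\otimes\Bbbk F$ with basis $p_g\# f:=p_g\otimes f$ ($g\in G,f\in F$; $\{p_g\}$ is the basis of $\Bbbk^G$ dual to $G\subset\Bbbk G$), multiplication $(p_g\# f)(p_{g'}\# f')=\delta_{g\triangleleft f,g'}\sigma(g;f,f')\,p_g\# ff'$, comultiplication $\Delta(p_g\# f)=\sum_{x\in G}\tau(gx^{-1},x;f)\,(p_{gx^{-1}}\#(x\triangleright f))\otimes(p_x\# f)$, unit $\sum_{g\in G}p_g\#1_F$, counit $\varepsilon(p_g\# f)=\delta_{g,1_G}$, and antipode $S(p_g\# f)=\sigma(g^{-1};g\triangleright f,(g\triangleright f)^{-1})^{-1}\tau(g^{-1},g;f)^{-1}p_{(g\triangleleft f)^{-1}}\#(g\triangleright f)^{-1}$. A coquasitriangular structure on a Hopf algebra $H$ is a convolution-invertible bilinear form $R:H\otimes H\to\Bbbk$ with $R(a,bc)=\sum R(a_{(1)},c)R(a_{(2)},b)$, $R(ab,c)=\sum R(a,c_{(1)})R(b,c_{(2)})$ and $\sum R(a_{(1)},b_{(1)})a_{(2)}b_{(2)}=\sum b_{(1)}a_{(1)}R(a_{(2)},b_{(2)})$ for all $a,b,c\in H$. For $f,f'\in F$: $O_f=\{g\triangleright f\mid g\in G\}$ and $O_fO_{f'}=\{xy\mid x\in O_f,\,y\in O_{f'}\}$. *)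

theory Defs
  imports
    "HOL-Algebra.Group_Action"
    "HOL-Library.Poly_Mapping"
    "HOL-Computational_Algebra.Polynomial"
begin

section \<open>Matched pairs of groups and compatible cocycles\<close>

text \<open>Here \<open>\<triangleleft>\<close> is a right action of \<open>F\<close> on the set \<open>carrier G\<close> and \<open>\<triangleright>\<close> is a left action
  of \<open>G\<close> on the set \<open>carrier F\<close>; neither acts by group automorphisms in general.\<close>

locale matched_pair = G: group G + F: group F
  for G :: "('g, 'm) monoid_scheme" and F :: "('f, 'n) monoid_scheme" +
  fixes ract :: "'g \<Rightarrow> 'f \<Rightarrow> 'g" (infixl "\<triangleleft>" 75)
    and lact :: "'g \<Rightarrow> 'f \<Rightarrow> 'f" (infixr "\<triangleright>" 75)
  assumes ract_closed: "\<lbrakk>g \<in> carrier G; f \<in> carrier F\<rbrakk> \<Longrightarrow> g \<triangleleft> f \<in> carrier G"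
    and ract_one: "g \<in> carrier G \<Longrightarrow> g \<triangleleft> \<one>\<^bsub>F\<^esub> = g"
    and ract_mult: "\<lbrakk>g \<in> carrier G; f \<in> carrier F; f' \<in> carrier F\<rbrakk>
      \<Longrightarrow> g \<triangleleft> (f \<otimes>\<^bsub>F\<^esub> f') = (g \<triangleleft> f) \<triangleleft> f'"
    and lact_closed: "\<lbrakk>g \<in> carrier G; f \<in> carrier F\<rbrakk> \<Longrightarrow> g \<triangleright> f \<in> carrier F"
    and lact_one: "f \<in> carrier F \<Longrightarrow> \<one>\<^bsub>G\<^esub> \<triangleright> f = f"
    and lact_mult: "\<lbrakk>g \<in> carrier G; g' \<in> carrier G; f \<in> carrier F\<rbrakk>
      \<Longrightarrow> (g \<otimes>\<^bsub>G\<^esub> g') \<triangleright> f = g \<triangleright> (g' \<triangleright> f)"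
    and lact_compat: "\<lbrakk>g \<in> carrier G; f \<in> carrier F; f' \<in> carrier F\<rbrakk>
      \<Longrightarrow> g \<triangleright> (f \<otimes>\<^bsub>F\<^esub> f') = (g \<triangleright> f) \<otimes>\<^bsub>F\<^esub> ((g \<triangleleft> f) \<triangleright> f')"
    and ract_compat: "\<lbrakk>g \<in> carrier G; g' \<in> carrier G; f \<in> carrier F\<rbrakk>
      \<Longrightarrow> (g \<otimes>\<^bsub>G\<^esub> g') \<triangleleft> f = (g \<triangleleft> (g' \<triangleright> f)) \<otimes>\<^bsub>G\<^esub> (g' \<triangleleft> f)"

locale matched_pair_cocycles = matched_pair G F ract lact
  for G :: "('g, 'm) monoid_scheme" and F :: "('f, 'n) monoid_scheme"
    and ract :: "'g \<Rightarrow> 'f \<Rightarrow> 'g" (infixl "\<triangleleft>" 75)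
    and lact :: "'g \<Rightarrow> 'f \<Rightarrow> 'f" (infixr "\<triangleright>" 75) +
  fixes \<sigma> :: "'g \<Rightarrow> 'f \<Rightarrow> 'f \<Rightarrow> 'k :: field"
    and \<tau> :: "'g \<Rightarrow> 'g \<Rightarrow> 'f \<Rightarrow> 'k"
  assumes sigma_nonzero: "\<lbrakk>g \<in> carrier G; f \<in> carrier F; f' \<in> carrier F\<rbrakk> \<Longrightarrow> \<sigma> g f f' \<noteq> 0"
    and tau_nonzero: "\<lbrakk>g \<in> carrier G; g' \<in> carrier G; f \<in> carrier F\<rbrakk> \<Longrightarrow> \<tau> g g' f \<noteq> 0"
    and sigma_one_left: "\<lbrakk>g \<in> carrier G; f \<in> carrier F\<rbrakk> \<Longrightarrow> \<sigma> g \<one>\<^bsub>F\<^esub> f = 1"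
    and sigma_one_right: "\<lbrakk>g \<in> carrier G; f \<in> carrier F\<rbrakk> \<Longrightarrow> \<sigma> g f \<one>\<^bsub>F\<^esub> = 1"
    and sigma_one_G: "\<lbrakk>f \<in> carrier F; f' \<in> carrier F\<rbrakk> \<Longrightarrow> \<sigma> \<one>\<^bsub>G\<^esub> f f' = 1"
    and sigma_cocycle:
      "\<lbrakk>g \<in> carrier G; f \<in> carrier F; f' \<in> carrier F; f'' \<in> carrier F\<rbrakk>
      \<Longrightarrow> \<sigma> (g \<triangleleft> f) f' f'' * \<sigma> g f (f' \<otimes>\<^bsub>F\<^esub> f'') = \<sigma> g f f' * \<sigma> g (f \<otimes>\<^bsub>F\<^esub> f') f''"
    and tau_one_left: "\<lbrakk>g \<in> carrier G; f \<in> carrier F\<rbrakk> \<Longrightarrow> \<tau> \<one>\<^bsub>G\<^esub> g f = 1"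
    and tau_one_right: "\<lbrakk>g \<in> carrier G; f \<in> carrier F\<rbrakk> \<Longrightarrow> \<tau> g \<one>\<^bsub>G\<^esub> f = 1"
    and tau_one_F: "\<lbrakk>g \<in> carrier G; g' \<in> carrier G\<rbrakk> \<Longrightarrow> \<tau> g g' \<one>\<^bsub>F\<^esub> = 1"
    and tau_cocycle:
      "\<lbrakk>g \<in> carrier G; g' \<in> carrier G; g'' \<in> carrier G; f \<in> carrier F\<rbrakk>
      \<Longrightarrow> \<tau> g g' (g'' \<triangleright> f) * \<tau> (g \<otimes>\<^bsub>G\<^esub> g') g'' f = \<tau> g (g' \<otimes>\<^bsub>G\<^esub> g'') f * \<tau> g' g'' f"
    and sigma_tau_compat:
      "\<lbrakk>g \<in> carrier G; g' \<in> carrier G; f \<in> carrier F; f' \<in> carrier F\<rbrakk>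
      \<Longrightarrow> \<sigma> (g \<otimes>\<^bsub>G\<^esub> g') f f' * \<tau> g g' (f \<otimes>\<^bsub>F\<^esub> f')
        = \<sigma> g (g' \<triangleright> f) ((g' \<triangleleft> f) \<triangleright> f') * \<sigma> g' f f' * \<tau> g g' f
          * \<tau> (g \<triangleleft> (g' \<triangleright> f)) (g' \<triangleleft> f) f'"


section \<open>Hopf algebras presented on a basis\<close>

text \<open>A vector space with basis \<open>B\<close> is modelled as the finitely supported functions
  \<open>'b \<Rightarrow>\<^sub>0 'k\<close> whose keys lie in \<open>B\<close>; its tensor square is then the space with basis \<open>B \<times> B\<close>,
  that is, consists of elements of \<open>('b \<times> 'b) \<Rightarrow>\<^sub>0 'k\<close>.\<close>

definition smul :: "'k :: field \<Rightarrow> ('b \<Rightarrow>\<^sub>0 'k) \<Rightarrow> ('b \<Rightarrow>\<^sub>0 'k)" where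
  "smul c v = Poly_Mapping.map (\<lambda>x. c * x) v"

text \<open>Linear extension of a map given on basis elements.  The scalar multiplication \<open>scale\<close> of the
  codomain is \<open>(*)\<close> for scalar-valued maps and \<open>smul\<close> for vector-valued ones.\<close>

definition lin_ext ::
  "('k \<Rightarrow> 'v \<Rightarrow> 'v) \<Rightarrow> ('b \<Rightarrow> 'v) \<Rightarrow> ('b \<Rightarrow>\<^sub>0 'k :: field) \<Rightarrow> 'v :: comm_monoid_add" where
  "lin_ext scale \<phi> v = (\<Sum>x\<in>Poly_Mapping.keys v. scale (Poly_Mapping.lookup v x) (\<phi> x))"

text \<open>Sweedler notation: for a bilinear map \<open>\<phi>\<close> and \<open>t = \<Delta> a\<close>, the value of \<open>sweedler scale t \<phi>\<close> is
  the sum of all \<open>\<phi> a\<^sub>1 a\<^sub>2\<close>.\<close>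

definition sweedler ::
  "('k \<Rightarrow> 'v \<Rightarrow> 'v) \<Rightarrow> ('b \<times> 'b \<Rightarrow>\<^sub>0 'k :: field)
    \<Rightarrow> (('b \<Rightarrow>\<^sub>0 'k) \<Rightarrow> ('b \<Rightarrow>\<^sub>0 'k) \<Rightarrow> 'v :: comm_monoid_add) \<Rightarrow> 'v" where
  "sweedler scale t \<phi> =
    lin_ext scale (\<lambda>(x, y). \<phi> (Poly_Mapping.single x 1) (Poly_Mapping.single y 1)) t"

record (overloaded) ('b, 'k) hopf_data =
  hspace :: "('b \<Rightarrow>\<^sub>0 'k :: zero) set"
  hmult :: "('b \<Rightarrow>\<^sub>0 'k) \<Rightarrow> ('b \<Rightarrow>\<^sub>0 'k) \<Rightarrow> ('b \<Rightarrow>\<^sub>0 'k)"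
  hunit :: "'b \<Rightarrow>\<^sub>0 'k"
  hcomult :: "('b \<Rightarrow>\<^sub>0 'k) \<Rightarrow> ('b \<times> 'b \<Rightarrow>\<^sub>0 'k)"
  hcounit :: "('b \<Rightarrow>\<^sub>0 'k) \<Rightarrow> 'k"
  hantipode :: "('b \<Rightarrow>\<^sub>0 'k) \<Rightarrow> ('b \<Rightarrow>\<^sub>0 'k)"

definition bilinear_form_on ::
  "('b \<Rightarrow>\<^sub>0 'k :: field) set \<Rightarrow> (('b \<Rightarrow>\<^sub>0 'k) \<Rightarrow> ('b \<Rightarrow>\<^sub>0 'k) \<Rightarrow> 'k) \<Rightarrow> bool" where
  "bilinear_form_on V R \<longleftrightarrow>
    (\<forall>a\<in>V. \<forall>b\<in>V. \<forall>c\<in>V. R (a + b) c = R a c + R b c \<and> R a (b + c) = R a b + R a c) \<and>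
    (\<forall>s. \<forall>a\<in>V. \<forall>b\<in>V. R (smul s a) b = s * R a b \<and> R a (smul s b) = s * R a b)"

text \<open>The convolution product in the dual of the coalgebra \<open>H \<otimes> H\<close>.\<close>

definition convolution ::
  "('b, 'k :: field) hopf_data \<Rightarrow> (('b \<Rightarrow>\<^sub>0 'k) \<Rightarrow> ('b \<Rightarrow>\<^sub>0 'k) \<Rightarrow> 'k)
    \<Rightarrow> (('b \<Rightarrow>\<^sub>0 'k) \<Rightarrow> ('b \<Rightarrow>\<^sub>0 'k) \<Rightarrow> 'k) \<Rightarrow> (('b \<Rightarrow>\<^sub>0 'k) \<Rightarrow> ('b \<Rightarrow>\<^sub>0 'k) \<Rightarrow> 'k)" where
  "convolution H R Q = (\<lambda>a b.
    sweedler (*) (hcomult H a) (\<lambda>a\<^sub>1 a\<^sub>2. sweedler (*) (hcomult H b) (\<lambda>b\<^sub>1 b\<^sub>2. R a\<^sub>1 b\<^sub>1 * Q a\<^sub>2 b\<^sub>2)))"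

definition convolution_invertible ::
  "('b, 'k :: field) hopf_data \<Rightarrow> (('b \<Rightarrow>\<^sub>0 'k) \<Rightarrow> ('b \<Rightarrow>\<^sub>0 'k) \<Rightarrow> 'k) \<Rightarrow> bool" where
  "convolution_invertible H R \<longleftrightarrow>
    (\<exists>Q. bilinear_form_on (hspace H) Q \<and>
      (\<forall>a\<in>hspace H. \<forall>b\<in>hspace H.
        convolution H R Q a b = hcounit H a * hcounit H b \<and>
        convolution H Q R a b = hcounit H a * hcounit H b))"

definition coquasitriangular_structure ::
  "('b, 'k :: field) hopf_data \<Rightarrow> (('b \<Rightarrow>\<^sub>0 'k) \<Rightarrow> ('b \<Rightarrow>\<^sub>0 'k) \<Rightarrow> 'k) \<Rightarrow> bool" where
  "coquasitriangular_structure H R \<longleftrightarrow>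
    bilinear_form_on (hspace H) R \<and>
    convolution_invertible H R \<and>
    (\<forall>a\<in>hspace H. \<forall>b\<in>hspace H. \<forall>c\<in>hspace H.
      R a (hmult H b c) = sweedler (*) (hcomult H a) (\<lambda>a\<^sub>1 a\<^sub>2. R a\<^sub>1 c * R a\<^sub>2 b)) \<and>
    (\<forall>a\<in>hspace H. \<forall>b\<in>hspace H. \<forall>c\<in>hspace H.
      R (hmult H a b) c = sweedler (*) (hcomult H c) (\<lambda>c\<^sub>1 c\<^sub>2. R a c\<^sub>1 * R b c\<^sub>2)) \<and>
    (\<forall>a\<in>hspace H. \<forall>b\<in>hspace H.
      sweedler smul (hcomult H a) (\<lambda>a\<^sub>1 a\<^sub>2. sweedler smul (hcomult H b) (\<lambda>b\<^sub>1 b\<^sub>2.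
        smul (R a\<^sub>1 b\<^sub>1) (hmult H a\<^sub>2 b\<^sub>2))) =
      sweedler smul (hcomult H a) (\<lambda>a\<^sub>1 a\<^sub>2. sweedler smul (hcomult H b) (\<lambda>b\<^sub>1 b\<^sub>2.
        smul (R a\<^sub>2 b\<^sub>2) (hmult H b\<^sub>1 a\<^sub>1))))"

definition admits_coquasitriangular_structure :: "('b, 'k :: field) hopf_data \<Rightarrow> bool" where
  "admits_coquasitriangular_structure H \<longleftrightarrow> (\<exists>R. coquasitriangular_structure H R)"


section \<open>The bicrossed product of the function algebra of \<open>G\<close> and the group algebra of \<open>F\<close>\<close>

text \<open>The basis element \<open>p\<^sub>g # f\<close> is represented by the pair \<open>(g, f)\<close>.\<close>

definition bicrossed_product ::
  "('g, 'm) monoid_scheme \<Rightarrow> ('f, 'n) monoid_scheme \<Rightarrow> ('g \<Rightarrow> 'f \<Rightarrow> 'g) \<Rightarrow> ('g \<Rightarrow> 'f \<Rightarrow> 'f)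
    \<Rightarrow> ('g \<Rightarrow> 'f \<Rightarrow> 'f \<Rightarrow> 'k) \<Rightarrow> ('g \<Rightarrow> 'g \<Rightarrow> 'f \<Rightarrow> 'k) \<Rightarrow> ('g \<times> 'f, 'k :: field) hopf_data" where
  "bicrossed_product G F ract lact \<sigma> \<tau> = \<lparr>
    hspace = {v. Poly_Mapping.keys v \<subseteq> carrier G \<times> carrier F},
    hmult = (\<lambda>a b. lin_ext smul (\<lambda>(g, f). lin_ext smul (\<lambda>(g', f').
        if ract g f = g' then Poly_Mapping.single (g, f \<otimes>\<^bsub>F\<^esub> f') (\<sigma> g f f') else 0) b) a),
    hunit = (\<Sum>g\<in>carrier G. Poly_Mapping.single (g, \<one>\<^bsub>F\<^esub>) 1),
    hcomult = lin_ext smul (\<lambda>(g, f). \<Sum>x\<in>carrier G.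
        Poly_Mapping.single ((g \<otimes>\<^bsub>G\<^esub> inv\<^bsub>G\<^esub> x, lact x f), (x, f)) (\<tau> (g \<otimes>\<^bsub>G\<^esub> inv\<^bsub>G\<^esub> x) x f)),
    hcounit = lin_ext (*) (\<lambda>(g, f). if g = \<one>\<^bsub>G\<^esub> then 1 else 0),
    hantipode = lin_ext smul (\<lambda>(g, f).
        Poly_Mapping.single (inv\<^bsub>G\<^esub> (ract g f), inv\<^bsub>F\<^esub> (lact g f))
          (inverse (\<sigma> (inv\<^bsub>G\<^esub> g) (lact g f) (inv\<^bsub>F\<^esub> (lact g f)))
            * inverse (\<tau> (inv\<^bsub>G\<^esub> g) g f)))
  \<rparr>"

end

theory Submission
  imports Defs
begin

text \<open>Projecting \<open>p\<^sub>g # f\<close> to \<open>f\<close> if \<open>g = 1\<close> and to \<open>0\<close> otherwise is a Hopf algebra map from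
  \<open>H\<close>, the bicrossed product, to the group algebra of \<open>F\<close>.  Hence every \<open>H\<close>-comodule is graded by
  \<open>F\<close>, and supports multiply under tensor products.  The span of the \<open>p\<^sub>g # h\<close> with \<open>h\<close> in an orbit
  \<open>O\<close> is a subcoalgebra, and as a comodule it has support \<open>O\<close>.  A coquasitriangular structure gives a
  natural isomorphism \<open>V \<otimes> W \<cong> W \<otimes> V\<close> of comodules, so the two tensor products have the same
  support, that is, \<open>O O' = O' O\<close>.

  The proof below carries out this idea on basis elements.  In the identity
  \<open>\<Sum> R(a\<^sub>1, b\<^sub>1) a\<^sub>2 b\<^sub>2 = \<Sum> b\<^sub>1 a\<^sub>1 R(a\<^sub>2, b\<^sub>2)\<close> for \<open>a = p\<^sub>g # f\<close> and \<open>b = p\<^sub>g\<^sub>' # f'\<close>, every term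
  on the left lies over \<open>f f'\<close>, while on the right the part with \<open>G\<close>-component \<open>1\<close> is the
  single term \<open>R(a, b) p\<^sub>1 # (g' \<triangleright> f')(g \<triangleright> f)\<close>.  So \<open>R(a, b) \<noteq> 0\<close> forces
  \<open>(g' \<triangleright> f')(g \<triangleright> f) = f f'\<close> (\<open>coquasitriangular_support\<close>).  Convolution
  invertibility at \<open>(p\<^sub>1 # f, p\<^sub>1 # f')\<close> provides \<open>x, y\<close> such that \<open>R\<close> does not vanish at
  \<open>p\<^sub>u # (x \<triangleright> f)\<close> and \<open>p\<^sub>v # (y \<triangleright> f')\<close>, where \<open>u, v\<close> are the inverses of \<open>x, y\<close>, and then
  \<open>f' f = (x \<triangleright> f)(y \<triangleright> f')\<close> lies in \<open>O\<^sub>f O\<^sub>f\<^sub>'\<close>.\<close>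

lemma lookup_smul: "Poly_Mapping.lookup (smul c v) z = c * Poly_Mapping.lookup v z"
  by (simp add: smul_def Poly_Mapping.map.rep_eq when_def)

lemma smul_zero_left: "smul 0 v = 0"
  by (rule poly_mapping_eqI) (simp add: lookup_smul)

lemma smul_one: "smul 1 v = v"
  by (rule poly_mapping_eqI) (simp add: lookup_smul)

lemma lin_ext_sum_single:
  assumes "finite A" and inj: "inj_on k A" and zero: "\<And>v. scale 0 v = 0"
  shows "lin_ext scale \<phi> (\<Sum>x\<in>A. Poly_Mapping.single (k x) (c x)) = (\<Sum>x\<in>A. scale (c x) (\<phi> (k x)))"
proof -
  let ?v = "\<Sum>x\<in>A. Poly_Mapping.single (k x) (c x)"
  have lookup: "Poly_Mapping.lookup ?v (k x) = c x" if "x \<in> A" for x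
  proof -
    have "Poly_Mapping.lookup ?v (k x) = (\<Sum>y\<in>A. if y = x then c x else 0)"
      unfolding lookup_sum lookup_single when_def
      using inj that by (intro sum.cong) (auto simp: inj_on_def)
    then show ?thesis using that \<open>finite A\<close> by simp
  qed
  have keys: "Poly_Mapping.keys ?v \<subseteq> k ` A"
    using keys_sum[of "\<lambda>x. Poly_Mapping.single (k x) (c x)" A]
    by (fastforce split: if_splits)
  have "lin_ext scale \<phi> ?v = (\<Sum>z\<in>k ` A. scale (Poly_Mapping.lookup ?v z) (\<phi> z))"
    unfolding lin_ext_def using \<open>finite A\<close> keys
    by (intro sum.mono_neutral_left) (auto simp: zero in_keys_iff)
  also have "\<dots> = (\<Sum>x\<in>A. scale (c x) (\<phi> (k x)))"
    by (simp add: sum.reindex[OF inj] lookup)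
  finally show ?thesis .
qed

lemma lin_ext_single:
  assumes "\<And>v. scale 0 v = 0"
  shows "lin_ext scale \<phi> (Poly_Mapping.single x c) = scale c (\<phi> x)"
  using lin_ext_sum_single[of "{x}" "\<lambda>x. x" scale \<phi> "\<lambda>_. c"] assms by simp

lemma (in matched_pair) one_ract:
  assumes "f \<in> carrier F"
  shows "\<one>\<^bsub>G\<^esub> \<triangleleft> f = \<one>\<^bsub>G\<^esub>"
  \<comment> \<open>The element is idempotent, by the compatibility of \<open>\<triangleleft>\<close> with the product of \<open>G\<close>.\<close>
  using ract_compat[of "\<one>\<^bsub>G\<^esub>" "\<one>\<^bsub>G\<^esub>" f] ract_closed[of "\<one>\<^bsub>G\<^esub>" f] assms
  by (simp add: lact_one)

lemma (in matched_pair) inv_lact_lact: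
  assumes "g \<in> carrier G" "f \<in> carrier F"
  shows "inv\<^bsub>G\<^esub> g \<triangleright> (g \<triangleright> f) = f"
  using assms lact_mult[of "inv\<^bsub>G\<^esub> g" g f] by (simp add: lact_one)

lemma (in matched_pair) orbit_subset:
  "f \<in> carrier F \<Longrightarrow> orbit G lact f \<subseteq> carrier F"
  by (auto simp: orbit_def lact_closed)

lemma (in matched_pair) orbit_trans:
  assumes "f \<in> carrier F" "h \<in> orbit G lact f"
  shows "orbit G lact h \<subseteq> orbit G lact f"
  using assms by (auto simp: orbit_def lact_mult[symmetric])

context matched_pair_cocycles
begin

abbreviation H where "H \<equiv> bicrossed_product G F ract lact \<sigma> \<tau>"

abbreviation basis :: "'g \<Rightarrow> 'f \<Rightarrow> 'g \<times> 'f \<Rightarrow>\<^sub>0 'k" where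
  "basis g f \<equiv> Poly_Mapping.single (g, f) 1"

lemma basis_in_hspace: "\<lbrakk>g \<in> carrier G; f \<in> carrier F\<rbrakk> \<Longrightarrow> basis g f \<in> hspace H"
  by (simp add: bicrossed_product_def)

lemma hmult_basis:
  "hmult H (basis g f) (basis g' f') =
    (if g \<triangleleft> f = g' then Poly_Mapping.single (g, f \<otimes>\<^bsub>F\<^esub> f') (\<sigma> g f f') else 0)"
  by (simp add: bicrossed_product_def lin_ext_single smul_zero_left smul_one)

lemma hcounit_basis: "hcounit H (basis g f) = (if g = \<one>\<^bsub>G\<^esub> then 1 else 0)"
  by (simp add: bicrossed_product_def lin_ext_single)

lemma sweedler_basis:
  assumes "finite (carrier G)" and zero: "\<And>v. scale 0 v = 0"
  shows "sweedler scale (hcomult H (basis g f)) \<Phi> =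
    (\<Sum>x\<in>carrier G. scale (\<tau> (g \<otimes>\<^bsub>G\<^esub> inv\<^bsub>G\<^esub> x) x f)
      (\<Phi> (basis (g \<otimes>\<^bsub>G\<^esub> inv\<^bsub>G\<^esub> x) (x \<triangleright> f)) (basis x f)))"
  using assms
  by (simp add: sweedler_def bicrossed_product_def lin_ext_single smul_zero_left smul_one
      lin_ext_sum_single inj_on_def)

text \<open>Why the coefficient is taken at \<open>p\<^sub>1 # (g' \<triangleright> f')(g \<triangleright> f)\<close>: since \<open>1 \<triangleleft> h = 1\<close>, a product
  \<open>b\<^sub>1 a\<^sub>1\<close> has a part with \<open>G\<close>-component \<open>1\<close> only if both factors do, and this singles out one term
  of each of the two coproducts.  There the cocycles are normalized, so no coefficient
  remains.\<close>

lemma lookup_flipped_product: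
  assumes fin: "finite (carrier G)"
    and g: "g \<in> carrier G" "g' \<in> carrier G" and f: "f \<in> carrier F" "f' \<in> carrier F"
  shows "Poly_Mapping.lookup
      (sweedler smul (hcomult H (basis g f)) (\<lambda>a\<^sub>1 a\<^sub>2.
        sweedler smul (hcomult H (basis g' f')) (\<lambda>b\<^sub>1 b\<^sub>2. smul (R a\<^sub>2 b\<^sub>2) (hmult H b\<^sub>1 a\<^sub>1))))
      (\<one>\<^bsub>G\<^esub>, (g' \<triangleright> f') \<otimes>\<^bsub>F\<^esub> (g \<triangleright> f)) = R (basis g f) (basis g' f')"
proof -
  let ?z = "(\<one>\<^bsub>G\<^esub>, (g' \<triangleright> f') \<otimes>\<^bsub>F\<^esub> (g \<triangleright> f))"
  have quotient_one: "(u \<otimes>\<^bsub>G\<^esub> inv\<^bsub>G\<^esub> v = \<one>\<^bsub>G\<^esub>) = (v = u)"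
    if "u \<in> carrier G" "v \<in> carrier G" for u v
    using that G.inv_solve_right[of "\<one>\<^bsub>G\<^esub>" u v] by auto
  have coeff: "Poly_Mapping.lookup (hmult H (basis (g' \<otimes>\<^bsub>G\<^esub> inv\<^bsub>G\<^esub> y) (y \<triangleright> f'))
        (basis (g \<otimes>\<^bsub>G\<^esub> inv\<^bsub>G\<^esub> x) (x \<triangleright> f))) ?z = (if x = g \<and> y = g' then 1 else 0)"
    if xy: "x \<in> carrier G" "y \<in> carrier G" for x y
  proof (cases "y = g'")
    case True
    have "\<one>\<^bsub>G\<^esub> \<triangleleft> (g' \<triangleright> f') = \<one>\<^bsub>G\<^esub>" "\<sigma> \<one>\<^bsub>G\<^esub> (g' \<triangleright> f') (g \<triangleright> f) = 1"
      using g f by (simp_all add: one_ract sigma_one_G lact_closed)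
    moreover have "(\<one>\<^bsub>G\<^esub> = g \<otimes>\<^bsub>G\<^esub> inv\<^bsub>G\<^esub> x) = (x = g)"
      using quotient_one[OF g(1) xy(1)] by auto
    ultimately show ?thesis using True g by (auto simp: hmult_basis)
  next
    case False
    then show ?thesis
      using quotient_one[OF g(2) xy(2)] by (simp add: hmult_basis lookup_single when_def)
  qed
  have "Poly_Mapping.lookup
      (sweedler smul (hcomult H (basis g f)) (\<lambda>a\<^sub>1 a\<^sub>2.
        sweedler smul (hcomult H (basis g' f')) (\<lambda>b\<^sub>1 b\<^sub>2. smul (R a\<^sub>2 b\<^sub>2) (hmult H b\<^sub>1 a\<^sub>1)))) ?z
    = (\<Sum>x\<in>carrier G. \<tau> (g \<otimes>\<^bsub>G\<^esub> inv\<^bsub>G\<^esub> x) x f * (\<Sum>y\<in>carrier G. \<tau> (g' \<otimes>\<^bsub>G\<^esub> inv\<^bsub>G\<^esub> y) y f' *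
        (R (basis x f) (basis y f') * (if x = g \<and> y = g' then 1 else 0))))"
    using fin by (simp add: sweedler_basis smul_zero_left lookup_sum lookup_smul coeff)
  also have "\<dots> = (\<Sum>x\<in>carrier G. if x = g then R (basis g f) (basis g' f') else 0)"
  proof (rule sum.cong[OF refl])
    fix x assume "x \<in> carrier G"
    have "(\<Sum>y\<in>carrier G. \<tau> (g' \<otimes>\<^bsub>G\<^esub> inv\<^bsub>G\<^esub> y) y f' *
        (R (basis x f) (basis y f') * (if x = g \<and> y = g' then 1 else 0)))
      = (\<Sum>y\<in>carrier G. if y = g' then (if x = g then R (basis g f) (basis g' f') else 0) else 0)"
      using g f by (intro sum.cong) (auto simp: tau_one_left)
    also have "\<dots> = (if x = g then R (basis g f) (basis g' f') else 0)"
      using fin g by simp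
    finally show "\<tau> (g \<otimes>\<^bsub>G\<^esub> inv\<^bsub>G\<^esub> x) x f * (\<Sum>y\<in>carrier G. \<tau> (g' \<otimes>\<^bsub>G\<^esub> inv\<^bsub>G\<^esub> y) y f' *
        (R (basis x f) (basis y f') * (if x = g \<and> y = g' then 1 else 0)))
      = (if x = g then R (basis g f) (basis g' f') else 0)"
      using g f by (auto simp: tau_one_left)
  qed
  also have "\<dots> = R (basis g f) (basis g' f')"
    using fin g by simp
  finally show ?thesis .
qed

text \<open>In the coproduct of \<open>p\<^sub>g # f\<close> all second tensor factors have the same \<open>F\<close>-component \<open>f\<close>; this
  is why no other products than \<open>f f'\<close> occur.\<close>

lemma lookup_product_eq_0:
  assumes "finite (carrier G)" and "h \<noteq> f \<otimes>\<^bsub>F\<^esub> f'"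
  shows "Poly_Mapping.lookup
      (sweedler smul (hcomult H (basis g f)) (\<lambda>a\<^sub>1 a\<^sub>2.
        sweedler smul (hcomult H (basis g' f')) (\<lambda>b\<^sub>1 b\<^sub>2. smul (R a\<^sub>1 b\<^sub>1) (hmult H a\<^sub>2 b\<^sub>2))))
      (u, h) = 0"
proof -
  have "Poly_Mapping.lookup (hmult H (basis x f) (basis y f')) (u, h) = 0" for x y
    using assms by (simp add: hmult_basis lookup_single when_def)
  then show ?thesis
    using assms by (simp add: sweedler_basis smul_zero_left lookup_sum lookup_smul)
qed

lemma coquasitriangular_support:
  assumes fin: "finite (carrier G)" and R: "coquasitriangular_structure H R"
    and g: "g \<in> carrier G" "g' \<in> carrier G" and f: "f \<in> carrier F" "f' \<in> carrier F"
    and nonzero: "R (basis g f) (basis g' f') \<noteq> 0"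
  shows "(g' \<triangleright> f') \<otimes>\<^bsub>F\<^esub> (g \<triangleright> f) = f \<otimes>\<^bsub>F\<^esub> f'"
proof (rule ccontr)
  assume neq: "(g' \<triangleright> f') \<otimes>\<^bsub>F\<^esub> (g \<triangleright> f) \<noteq> f \<otimes>\<^bsub>F\<^esub> f'"
  have eq:
    "sweedler smul (hcomult H (basis g f)) (\<lambda>a\<^sub>1 a\<^sub>2.
       sweedler smul (hcomult H (basis g' f')) (\<lambda>b\<^sub>1 b\<^sub>2. smul (R a\<^sub>1 b\<^sub>1) (hmult H a\<^sub>2 b\<^sub>2))) =
     sweedler smul (hcomult H (basis g f)) (\<lambda>a\<^sub>1 a\<^sub>2.
       sweedler smul (hcomult H (basis g' f')) (\<lambda>b\<^sub>1 b\<^sub>2. smul (R a\<^sub>2 b\<^sub>2) (hmult H b\<^sub>1 a\<^sub>1)))"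
    using R basis_in_hspace[OF g(1) f(1)] basis_in_hspace[OF g(2) f(2)]
    unfolding coquasitriangular_structure_def by blast
  have "R (basis g f) (basis g' f') = 0"
    using lookup_flipped_product[OF fin g f, of R, folded eq]
    unfolding lookup_product_eq_0[OF fin neq] by (rule sym)
  with nonzero show False ..
qed

lemma flipped_product_in_orbit_product:
  assumes fin: "finite (carrier G)" and R: "coquasitriangular_structure H R"
    and f: "f \<in> carrier F" "f' \<in> carrier F"
  shows "f' \<otimes>\<^bsub>F\<^esub> f \<in> orbit G lact f <#>\<^bsub>F\<^esub> orbit G lact f'"
proof -
  obtain Q where Q: "\<forall>a\<in>hspace H. \<forall>b\<in>hspace H.
      convolution H R Q a b = hcounit H a * hcounit H b"
  proof -
    have "convolution_invertible H R"
      using R by (simp only: coquasitriangular_structure_def)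
    then show ?thesis
      using that unfolding convolution_invertible_def by blast
  qed
  have one: "convolution H R Q (basis \<one>\<^bsub>G\<^esub> f) (basis \<one>\<^bsub>G\<^esub> f') = 1"
    using Q f by (simp add: basis_in_hspace hcounit_basis)
  obtain x y where xy: "x \<in> carrier G" "y \<in> carrier G"
    and "R (basis (inv\<^bsub>G\<^esub> x) (x \<triangleright> f)) (basis (inv\<^bsub>G\<^esub> y) (y \<triangleright> f')) \<noteq> 0"
  proof (rule ccontr)
    assume "\<not> thesis"
    then have "\<And>x y. \<lbrakk>x \<in> carrier G; y \<in> carrier G\<rbrakk>
        \<Longrightarrow> R (basis (inv\<^bsub>G\<^esub> x) (x \<triangleright> f)) (basis (inv\<^bsub>G\<^esub> y) (y \<triangleright> f')) = 0"
      using that by blast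
    then have "convolution H R Q (basis \<one>\<^bsub>G\<^esub> f) (basis \<one>\<^bsub>G\<^esub> f') = 0"
      using fin by (simp add: convolution_def sweedler_basis)
    with one show False by simp
  qed
  then have "f' \<otimes>\<^bsub>F\<^esub> f = (x \<triangleright> f) \<otimes>\<^bsub>F\<^esub> (y \<triangleright> f')"
    using coquasitriangular_support[OF fin R, of "inv\<^bsub>G\<^esub> x" "inv\<^bsub>G\<^esub> y" "x \<triangleright> f" "y \<triangleright> f'"] f
    by (simp add: inv_lact_lact lact_closed)
  then show ?thesis
    using xy by (auto simp: set_mult_def orbit_def)
qed

lemma orbit_product_subset:
  assumes fin: "finite (carrier G)" and R: "coquasitriangular_structure H R"
    and f: "f \<in> carrier F" "f' \<in> carrier F"
  shows "orbit G lact f' <#>\<^bsub>F\<^esub> orbit G lact f \<subseteq> orbit G lact f <#>\<^bsub>F\<^esub> orbit G lact f'"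
proof
  fix z assume "z \<in> orbit G lact f' <#>\<^bsub>F\<^esub> orbit G lact f"
  then obtain h' h where h: "h' \<in> orbit G lact f'" "h \<in> orbit G lact f" "z = h' \<otimes>\<^bsub>F\<^esub> h"
    by (auto simp: set_mult_def)
  then have "z \<in> orbit G lact h <#>\<^bsub>F\<^esub> orbit G lact h'"
    using flipped_product_in_orbit_product[OF fin R] orbit_subset f by blast
  also have "\<dots> \<subseteq> orbit G lact f <#>\<^bsub>F\<^esub> orbit G lact f'"
    using orbit_trans[OF f(1) h(2)] orbit_trans[OF f(2) h(1)] by (rule mono_set_mult)
  finally show "z \<in> orbit G lact f <#>\<^bsub>F\<^esub> orbit G lact f'" .
qed

end

theorem theorem1p1:
  fixes G :: "('g, 'm) monoid_scheme" and F :: "('f, 'n) monoid_scheme"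
    and ract :: "'g \<Rightarrow> 'f \<Rightarrow> 'g" and lact :: "'g \<Rightarrow> 'f \<Rightarrow> 'f"
    and \<sigma> :: "'g \<Rightarrow> 'f \<Rightarrow> 'f \<Rightarrow> 'k :: {alg_closed_field, field_char_0}"
    and \<tau> :: "'g \<Rightarrow> 'g \<Rightarrow> 'f \<Rightarrow> 'k"
  assumes "matched_pair_cocycles G F ract lact \<sigma> \<tau>"
    and "finite (carrier G)"
    and "admits_coquasitriangular_structure (bicrossed_product G F ract lact \<sigma> \<tau>)"
  shows "\<forall>f\<in>carrier F. \<forall>f'\<in>carrier F.
    orbit G lact f <#>\<^bsub>F\<^esub> orbit G lact f' = orbit G lact f' <#>\<^bsub>F\<^esub> orbit G lact f"
proof -
  interpret matched_pair_cocycles G F ract lact \<sigma> \<tau> by fact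
  obtain R where "coquasitriangular_structure H R"
    using assms(3) unfolding admits_coquasitriangular_structure_def by blast
  then show ?thesis
    using orbit_product_subset[OF assms(2)] by blast
qed

end
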